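(* Let $G$ be a locally compact group, and let $H$ be a closed cocompact subgroup, i.e. there exists a compact subset $K\subset G$ such that $G=HK=\{hk:\;h\in H,\,k\in K\}$. Then $G$ is compactly presented if and only if $H$ is compactly presented.
   Context: Locally compact groups are assumed Hausdorff. A group $G$ is boundedly presented by a subset $S\subset G$ if, as an abstract group, it has a presentation with $S$ as set of generators and with relators of bounded length (as words in $S\cup S^{-1}$). A topological group $G$ is compactly presented if it is Hausdorff and there is a compact subset $S\subset G$ such that the abstract group $G$ is boundedly presented by $S$. The subgroup $H$ carries the induced topology. *)

theory Defs
  imports "HOL-Analysis.Analysis" "HOL-Algebra.Algebra"
begin

text \<open>
  The carrier of a topological group is a set rather than a type, because a closed subgroup with
  the induced topology must again be such a structure.
\<close>

locale topological_group = group G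
  for G :: "('a, 'b) monoid_scheme" (structure) and T :: "'a topology" +
  assumes topspace_eq: "topspace T = carrier G"
    and continuous_mult: "continuous_map (prod_topology T T) T (\<lambda>(x, y). x \<otimes> y)"
    and continuous_inv: "continuous_map T T (\<lambda>x. inv x)"

text \<open>
  The letter \<open>(s, True)\<close> stands for the generator \<open>s\<close> and \<open>(s, False)\<close> for its formal inverse.
  The two are distinct from each other, and from the letters of any other generator, whatever
  coincidences there may be in the group that is being presented.
\<close>

definition inv_letter :: "'s \<times> bool \<Rightarrow> 's \<times> bool" where
  "inv_letter x = (fst x, \<not> snd x)"

definition reduced :: "('s \<times> bool) list \<Rightarrow> bool" where
  "reduced w \<longleftrightarrow> successively (\<lambda>x y. y \<noteq> inv_letter x) w"

definition red_cons :: "'s \<times> bool \<Rightarrow> ('s \<times> bool) list \<Rightarrow> ('s \<times> bool) list" where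
  "red_cons x w = (if w \<noteq> [] \<and> hd w = inv_letter x then tl w else x # w)"

text \<open>
  The product of reduced words \<open>u\<close> and \<open>v\<close> prepends the letters of \<open>u\<close> to \<open>v\<close> one by one, from the
  last to the first, cancelling whenever possible: it is the reduced form of \<open>u @ v\<close>.
\<close>

definition free_group :: "'s set \<Rightarrow> ('s \<times> bool) list monoid" where
  "free_group S = \<lparr>carrier = {w. set w \<subseteq> S \<times> UNIV \<and> reduced w},
                   mult = (\<lambda>u v. foldr red_cons u v), one = []\<rparr>"

definition eval_word :: "('a, 'b) monoid_scheme \<Rightarrow> ('a \<times> bool) list \<Rightarrow> 'a" where
  "eval_word G w =
     foldr (\<lambda>(s, e) g. (if e then s else inv\<^bsub>G\<^esub> s) \<otimes>\<^bsub>G\<^esub> g) w \<one>\<^bsub>G\<^esub>"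

definition normal_closure :: "('a, 'b) monoid_scheme \<Rightarrow> 'a set \<Rightarrow> 'a set" where
  "normal_closure G R = \<Inter>{N. N \<lhd> G \<and> R \<subseteq> N}"

definition is_presentation ::
    "('a, 'b) monoid_scheme \<Rightarrow> 'a set \<Rightarrow> ('a \<times> bool) list set \<Rightarrow> bool" where
  "is_presentation G S R \<longleftrightarrow>
     S \<subseteq> carrier G \<and> R \<subseteq> carrier (free_group S) \<and>
     eval_word G ` carrier (free_group S) = carrier G \<and>
     kernel (free_group S) G (eval_word G) = normal_closure (free_group S) R"

definition boundedly_presented_by :: "('a, 'b) monoid_scheme \<Rightarrow> 'a set \<Rightarrow> bool" where
  "boundedly_presented_by G S \<longleftrightarrow>
     (\<exists>R n. is_presentation G S R \<and> (\<forall>r\<in>R. length r \<le> n))"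

definition compactly_presented :: "('a, 'b) monoid_scheme \<Rightarrow> 'a topology \<Rightarrow> bool" where
  "compactly_presented G T \<longleftrightarrow>
     Hausdorff_space T \<and> (\<exists>S. compactin T S \<and> boundedly_presented_by G S)"

text \<open>
  The remaining facts confirm that the words form a group, that evaluation is a homomorphism, and
  that it is the one extending the inclusion of the generators.
\<close>

lemma inv_letter_inv_letter [simp]: "inv_letter (inv_letter x) = x"
  by (simp add: inv_letter_def)

lemma inv_letter_neq [simp]: "inv_letter x \<noteq> x" "x \<noteq> inv_letter x"
  by (cases x; simp add: inv_letter_def)+

lemma reduced_Nil [simp]: "reduced []"
  by (simp add: reduced_def)

lemma reduced_Cons: "reduced (x # w) \<longleftrightarrow> reduced w \<and> (w \<noteq> [] \<longrightarrow> hd w \<noteq> inv_letter x)"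
  by (cases w) (auto simp: reduced_def)

lemma reduced_red_cons: "reduced w \<Longrightarrow> reduced (red_cons x w)"
  by (cases w) (auto simp: red_cons_def reduced_Cons)

lemma red_cons_cancel: "reduced w \<Longrightarrow> red_cons (inv_letter x) (red_cons x w) = w"
  by (cases w) (auto simp: red_cons_def reduced_Cons neq_Nil_conv)

lemma set_red_cons: "set (red_cons x w) \<subseteq> insert x (set w)"
  by (cases w) (auto simp: red_cons_def)

lemma reduced_foldr_red_cons: "reduced v \<Longrightarrow> reduced (foldr red_cons u v)"
  by (induction u) (auto simp: reduced_red_cons)

lemma set_foldr_red_cons: "set (foldr red_cons u v) \<subseteq> set u \<union> set v"
proof (induction u)
  case (Cons x u)
  show ?case
    using set_red_cons[of x "foldr red_cons u v"] Cons by auto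
qed simp

lemma foldr_red_cons_red_cons:
  assumes "reduced w" "reduced v"
  shows "foldr red_cons (red_cons x v) w = red_cons x (foldr red_cons v w)"
proof (cases "v \<noteq> [] \<and> hd v = inv_letter x")
  case True
  then obtain v' where v: "v = inv_letter x # v'" by (cases v) auto
  show ?thesis
    using red_cons_cancel[of "foldr red_cons v' w" "inv_letter x"] assms
    by (simp add: v red_cons_def[of x "inv_letter x # v'"] reduced_foldr_red_cons)
qed (auto simp: red_cons_def[of x v])

lemma foldr_red_cons_assoc:
  assumes "reduced w" "reduced v"
  shows "foldr red_cons (foldr red_cons u v) w = foldr red_cons u (foldr red_cons v w)"
  by (induction u) (simp_all add: assms foldr_red_cons_red_cons reduced_foldr_red_cons)

lemma foldr_red_cons_Nil: "reduced u \<Longrightarrow> foldr red_cons u [] = u"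
  by (induction u) (auto simp: reduced_Cons red_cons_def)

lemma foldr_red_cons_inverse:
  "reduced w \<Longrightarrow> foldr red_cons (rev (map inv_letter u)) (foldr red_cons u w) = w"
  by (induction u) (simp_all add: red_cons_cancel reduced_foldr_red_cons)

theorem group_free_group: "group (free_group S)"
proof (rule groupI)
  fix u assume u: "u \<in> carrier (free_group S)"
  let ?v = "foldr red_cons (rev (map inv_letter u)) []"
  have "set (rev (map inv_letter u)) \<subseteq> S \<times> UNIV"
    using u by (auto simp: free_group_def inv_letter_def)
  then have v: "?v \<in> carrier (free_group S)"
    using set_foldr_red_cons[of "rev (map inv_letter u)" "[]"]
    by (auto simp: free_group_def reduced_foldr_red_cons)
  have "?v \<otimes>\<^bsub>free_group S\<^esub> u = foldr red_cons (rev (map inv_letter u)) u"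
    using u by (simp add: free_group_def foldr_red_cons_assoc)
  also have "\<dots> = \<one>\<^bsub>free_group S\<^esub>"
    using u foldr_red_cons_inverse[of "[]" u]
    by (simp add: free_group_def foldr_red_cons_Nil)
  finally show "\<exists>v\<in>carrier (free_group S). v \<otimes>\<^bsub>free_group S\<^esub> u = \<one>\<^bsub>free_group S\<^esub>"
    using v by blast
next
  fix u v assume "u \<in> carrier (free_group S)" "v \<in> carrier (free_group S)"
  then show "u \<otimes>\<^bsub>free_group S\<^esub> v \<in> carrier (free_group S)"
    using set_foldr_red_cons[of u v] by (auto simp: free_group_def reduced_foldr_red_cons)
qed (auto simp: free_group_def foldr_red_cons_assoc)

lemma (in group) eval_word_closed:
  assumes "S \<subseteq> carrier G" "set w \<subseteq> S \<times> UNIV"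
  shows "eval_word G w \<in> carrier G"
  using assms by (induction w) (auto simp: eval_word_def)

lemma (in group) eval_word_red_cons:
  assumes "S \<subseteq> carrier G" "x \<in> S \<times> UNIV" "set w \<subseteq> S \<times> UNIV"
  shows "eval_word G (red_cons x w) = eval_word G (x # w)"
proof (cases "w \<noteq> [] \<and> hd w = inv_letter x")
  case True
  then obtain v where w: "w = inv_letter x # v" by (cases w) auto
  have "eval_word G v \<in> carrier G"
    using assms w by (intro eval_word_closed[of S]) auto
  then show ?thesis
    using assms w by (auto simp: red_cons_def inv_letter_def eval_word_def m_assoc[symmetric])
qed (auto simp: red_cons_def)

theorem (in group) eval_word_hom:
  assumes S: "S \<subseteq> carrier G"
  shows "eval_word G \<in> hom (free_group S) G"
proof (rule homI)
  fix u v assume u: "u \<in> carrier (free_group S)" and v: "v \<in> carrier (free_group S)"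
  have v': "set v \<subseteq> S \<times> UNIV" using v by (simp add: free_group_def)
  have "eval_word G (foldr red_cons u v) = eval_word G u \<otimes> eval_word G v"
    if "set u \<subseteq> S \<times> UNIV"
    using that
  proof (induction u)
    case Nil
    show ?case using eval_word_closed[OF S v'] by (simp add: eval_word_def)
  next
    case (Cons x u)
    have 1: "set (foldr red_cons u v) \<subseteq> S \<times> UNIV"
      using set_foldr_red_cons[of u v] Cons.prems v' by auto
    have 2: "eval_word G u \<in> carrier G" "eval_word G v \<in> carrier G"
      using Cons.prems v' by (auto intro!: eval_word_closed[OF S])
    have "eval_word G (x # foldr red_cons u v) = eval_word G (x # u) \<otimes> eval_word G v"
      using Cons.IH Cons.prems S 2
      by (cases x) (auto simp: eval_word_def[of _ "_ # _"] m_assoc simp flip: eval_word_def)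
    then show ?case
      using eval_word_red_cons[OF S _ 1, of x] Cons.prems by simp
  qed
  then show "eval_word G (u \<otimes>\<^bsub>free_group S\<^esub> v) = eval_word G u \<otimes> eval_word G v"
    using u by (simp add: free_group_def)
qed (use S in \<open>auto simp: free_group_def intro!: eval_word_closed[OF S]\<close>)

lemma (in group) eval_word_generator: "s \<in> carrier G \<Longrightarrow> eval_word G [(s, True)] = s"
  by (simp add: eval_word_def)

end

theory Submission
  imports Defs
begin

text \<open>
  A group is boundedly presented by a compact set iff it is presented, over a compact symmetric
  set \<open>S\<close> containing the identity, by the triangle relations \<open>x y = z\<close> between elements of \<open>S\<close>,
  i.e. iff every loop in the Cayley graph of \<open>S\<close> can be filled by triangles. Such a filling
  is carried along by every map that moves adjacent points to points at bounded distance. Writing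
  \<open>G = H K\<close> gives a retraction \<open>f : G \<rightarrow> H\<close> with \<open>f(g)\<inverse> g \<in> K\<close>; its increments lie in
  \<open>K S K\<inverse> \<inter> H\<close>, which is compact. A loop in \<open>H\<close> is filled in \<open>G\<close> and the filling is pushed to
  \<open>H\<close> by \<open>f\<close>; a loop in \<open>G\<close> is homotopic to its image under \<open>f\<close>, which is filled in \<open>H\<close>. The
  generating set may be enlarged to contain a given compact set because, by the Baire category
  theorem, every compact set lies in some ball of the word metric of a compact generating set.
\<close>

section \<open>Words modulo triangle relations\<close>

definition word_prod :: "('a, 'b) monoid_scheme \<Rightarrow> 'a list \<Rightarrow> 'a" where
  "word_prod G w = foldr (mult G) w \<one>\<^bsub>G\<^esub>"

definition word_ball :: "('a, 'b) monoid_scheme \<Rightarrow> 'a set \<Rightarrow> nat \<Rightarrow> 'a set" where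
  "word_ball G S n = word_prod G ` {w. set w \<subseteq> S \<and> length w \<le> n}"

text \<open>Words carry no formal inverses. If \<open>S\<close> is symmetric and contains the
  identity, then \<open>inv s\<close> is itself a letter and \<open>[s, inv s]\<close> shrinks
  through \<open>[\<one>]\<close> to \<open>[]\<close>, so this congruence already presents a group.
  Restricting \<open>refl\<close> to words over \<open>S\<close> keeps foreign letters out of every
  filling.\<close>

inductive tri_equiv :: "('a, 'b) monoid_scheme \<Rightarrow> 'a set \<Rightarrow> 'a list \<Rightarrow> 'a list \<Rightarrow> bool"
  for G :: "('a, 'b) monoid_scheme" (structure) and S :: "'a set"
where
  refl: "set w \<subseteq> S \<Longrightarrow> tri_equiv G S w w"
| sym: "tri_equiv G S v w \<Longrightarrow> tri_equiv G S w v"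
| trans: "tri_equiv G S u v \<Longrightarrow> tri_equiv G S v w \<Longrightarrow> tri_equiv G S u w"
| append: "tri_equiv G S u u' \<Longrightarrow> tri_equiv G S v v' \<Longrightarrow> tri_equiv G S (u @ v) (u' @ v')"
| triangle: "x \<in> S \<Longrightarrow> y \<in> S \<Longrightarrow> x \<otimes> y \<in> S \<Longrightarrow> tri_equiv G S [x, y] [x \<otimes> y]"
| one: "\<one> \<in> S \<Longrightarrow> tri_equiv G S [\<one>] []"

lemmas tri_equiv_trans [trans] = tri_equiv.trans

text \<open>In geometric terms the last two clauses say that the Cayley graph of \<open>S\<close> is
  connected and becomes simply connected once its triangles are glued in.\<close>

definition triangularly_presented_by :: "('a, 'b) monoid_scheme \<Rightarrow> 'a set \<Rightarrow> bool" where
  "triangularly_presented_by G S \<longleftrightarrow>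
     S \<subseteq> carrier G \<and> \<one>\<^bsub>G\<^esub> \<in> S \<and> (\<forall>s\<in>S. inv\<^bsub>G\<^esub> s \<in> S) \<and>
     (\<forall>g\<in>carrier G. \<exists>w. set w \<subseteq> S \<and> word_prod G w = g) \<and>
     (\<forall>w. set w \<subseteq> S \<longrightarrow> word_prod G w = \<one>\<^bsub>G\<^esub> \<longrightarrow> tri_equiv G S w [])"

lemma word_prod_simps [simp]:
  "word_prod G [] = \<one>\<^bsub>G\<^esub>" "word_prod G (x # w) = x \<otimes>\<^bsub>G\<^esub> word_prod G w"
  by (simp_all add: word_prod_def)

lemma word_prod_carrier_update [simp]: "word_prod (G\<lparr>carrier := H\<rparr>) = word_prod G"
  by (simp add: word_prod_def fun_eq_iff)

lemma word_ball_carrier_update [simp]: "word_ball (G\<lparr>carrier := H\<rparr>) = word_ball G"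
  by (simp add: word_ball_def fun_eq_iff)

text \<open>The rules mention only the product, the unit and \<open>S\<close>, never the carrier, so
  fillings in a subgroup and in the whole group by letters of \<open>S\<close> are the same
  thing.\<close>

lemma tri_equiv_carrier_update [simp]: "tri_equiv (G\<lparr>carrier := H\<rparr>) = tri_equiv G"
proof -
  have "tri_equiv G S u v" if "tri_equiv (G\<lparr>carrier := H\<rparr>) S u v" for S u v
    using that by (induction rule: tri_equiv.induct) (auto intro: tri_equiv.intros)
  moreover have "tri_equiv (G\<lparr>carrier := H\<rparr>) S u v" if "tri_equiv G S u v" for S u v
    using that
  proof (induction rule: tri_equiv.induct)
    case (triangle x y)
    then show ?case using tri_equiv.triangle[of x S y "G\<lparr>carrier := H\<rparr>"] by simp
  next
    case one
    then show ?case using tri_equiv.one[of "G\<lparr>carrier := H\<rparr>" S] by simp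
  qed (auto intro: tri_equiv.refl tri_equiv.sym tri_equiv.trans tri_equiv.append)
  ultimately show ?thesis by (auto simp: fun_eq_iff)
qed

lemma tri_equiv_mono: "tri_equiv G S u v \<Longrightarrow> S \<subseteq> S' \<Longrightarrow> tri_equiv G S' u v"
  by (induction rule: tri_equiv.induct) (auto intro: tri_equiv.intros)

lemma tri_equiv_set: "tri_equiv G S u v \<Longrightarrow> set u \<subseteq> S \<and> set v \<subseteq> S"
  by (induction rule: tri_equiv.induct) auto

lemma tri_equiv_Cons: "x \<in> S \<Longrightarrow> tri_equiv G S u v \<Longrightarrow> tri_equiv G S (x # u) (x # v)"
  using tri_equiv.append[of G S "[x]" "[x]" u v] by (simp add: tri_equiv.refl)

text \<open>Substitution letter by letter. The map \<open>h\<close> lets the new letters come from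
  another alphabet: it is \<open>id\<close> when elements of a ball are spelled out, and
  \<open>letter_value\<close> when words are lifted to the free group.\<close>

lemma tri_equiv_lift_words:
  assumes "\<And>x. x \<in> B \<Longrightarrow> \<exists>v. set v \<subseteq> A \<and> tri_equiv G S [x] (map h v)" and "set w \<subseteq> B"
  shows "\<exists>v. set v \<subseteq> A \<and> tri_equiv G S w (map h v)"
  using assms(2)
proof (induction w)
  case Nil
  show ?case by (rule exI[of _ "[]"]) (simp add: tri_equiv.refl)
next
  case (Cons x w)
  then obtain v where v: "set v \<subseteq> A" "tri_equiv G S w (map h v)" by auto
  obtain u where u: "set u \<subseteq> A" "tri_equiv G S [x] (map h u)" using assms(1)[of x] Cons by auto
  show ?case
    using tri_equiv.append[OF u(2) v(2)] u(1) v(1) by (intro exI[of _ "u @ v"]) simp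
qed

context group
begin

lemma mult_inv_cancel_left:
  "a \<in> carrier G \<Longrightarrow> b \<in> carrier G \<Longrightarrow> a \<otimes> (inv a \<otimes> b) = b"
  "a \<in> carrier G \<Longrightarrow> b \<in> carrier G \<Longrightarrow> inv a \<otimes> (a \<otimes> b) = b"
  by (simp_all add: m_assoc[symmetric])

lemma word_prod_closed [simp]: "set w \<subseteq> carrier G \<Longrightarrow> word_prod G w \<in> carrier G"
  by (induction w) auto

lemma word_prod_append:
  "set u \<subseteq> carrier G \<Longrightarrow> set v \<subseteq> carrier G \<Longrightarrow>
    word_prod G (u @ v) = word_prod G u \<otimes> word_prod G v"
  by (induction u) (auto simp: m_assoc)

lemma word_prod_rev_inv:
  "set w \<subseteq> carrier G \<Longrightarrow> word_prod G (rev (map (m_inv G) w)) = inv (word_prod G w)"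
proof (induction w)
  case (Cons x w)
  then have "set (rev (map (m_inv G) w)) \<subseteq> carrier G" by auto
  with Cons show ?case by (simp add: word_prod_append inv_mult_group del: set_rev set_map)
qed simp

lemma tri_equiv_word_prod:
  assumes "tri_equiv G S u v" "S \<subseteq> carrier G"
  shows "word_prod G u = word_prod G v"
  using assms(1)
proof (induction rule: tri_equiv.induct)
  case (append u u' v v')
  then show ?case
    using tri_equiv_set[of G S u u'] tri_equiv_set[of G S v v'] assms(2)
    by (simp add: word_prod_append subset_trans[OF _ assms(2)])
next
  case (triangle x y)
  then have "x \<in> carrier G" "y \<in> carrier G" using assms(2) by auto
  then show ?case by simp
qed auto

text \<open>The universal property of the triangle presentation: a map into a group that respects
  the triangles is constant on equivalence classes after multiplying out.\<close>

lemma tri_equiv_word_prod_hom: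
  assumes "tri_equiv G S u v" and "group L" and "\<And>x. x \<in> S \<Longrightarrow> \<phi> x \<in> carrier L"
    and hom: "\<And>x y. x \<in> S \<Longrightarrow> y \<in> S \<Longrightarrow> x \<otimes> y \<in> S \<Longrightarrow> \<phi> x \<otimes>\<^bsub>L\<^esub> \<phi> y = \<phi> (x \<otimes> y)"
  shows "word_prod L (map \<phi> u) = word_prod L (map \<phi> v)"
  using assms(1)
proof (induction rule: tri_equiv.induct)
  case (append u u' v v')
  have "set (map \<phi> w) \<subseteq> carrier L" if "set w \<subseteq> S" for w
    using that assms(3) by auto
  then show ?case
    using append tri_equiv_set[of G S u u'] tri_equiv_set[of G S v v']
    by (simp add: group.word_prod_append[OF assms(2)])
next
  case (triangle x y)
  interpret L: group L by fact
  show ?case using triangle assms(3) hom by simp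
next
  case one
  interpret L: group L by fact
  \<comment> \<open>The image of the identity is idempotent, hence trivial in
    \<open>L\<close>.\<close>
  show ?case using hom[of \<one> \<one>] one assms(3)[of \<one>] by simp
qed auto

section \<open>Balls of the word metric\<close>

lemma word_ballI: "set w \<subseteq> S \<Longrightarrow> length w \<le> n \<Longrightarrow> word_prod G w \<in> word_ball G S n"
  by (auto simp: word_ball_def)

lemma word_ball_mono: "S \<subseteq> S' \<Longrightarrow> m \<le> n \<Longrightarrow> word_ball G S m \<subseteq> word_ball G S' n"
  by (force simp: word_ball_def)

lemma word_ball_subset_carrier: "S \<subseteq> carrier G \<Longrightarrow> word_ball G S n \<subseteq> carrier G"
  by (auto simp: word_ball_def)

lemma subset_word_ball: "S \<subseteq> carrier G \<Longrightarrow> 1 \<le> n \<Longrightarrow> S \<subseteq> word_ball G S n"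
  using word_ballI[of "[x]" S n for x] by fastforce

lemma one_in_word_ball: "\<one> \<in> word_ball G S n"
  using word_ballI[of "[]" S n] by simp

lemma word_ball_mult:
  assumes "S \<subseteq> carrier G" "x \<in> word_ball G S m" "y \<in> word_ball G S n"
  shows "x \<otimes> y \<in> word_ball G S (m + n)"
proof -
  obtain u v where "set u \<subseteq> S" "length u \<le> m" "x = word_prod G u"
      "set v \<subseteq> S" "length v \<le> n" "y = word_prod G v"
    using assms(2,3) by (auto simp: word_ball_def)
  then show ?thesis
    using word_ballI[of "u @ v" S "m + n"] assms(1) by (simp add: word_prod_append)
qed

lemma word_ball_inv:
  assumes "S \<subseteq> carrier G" "\<And>s. s \<in> S \<Longrightarrow> inv s \<in> S" "x \<in> word_ball G S n"
  shows "inv x \<in> word_ball G S n"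
proof -
  obtain w where "set w \<subseteq> S" "length w \<le> n" "x = word_prod G w"
    using assms(3) by (auto simp: word_ball_def)
  then show ?thesis
    using word_ballI[of "rev (map (m_inv G) w)" S n] assms(1,2)
    by (auto simp: word_prod_rev_inv image_subset_iff subset_iff)
qed

text \<open>The inserted identity is the value of the empty word, the only word without a first
  letter to split off. This recursion turns compactness of balls into an induction.\<close>

lemma word_ball_Suc: "word_ball G S (Suc n) = insert \<one> (S <#> word_ball G S n)"
proof (intro equalityI subsetI)
  fix x assume "x \<in> word_ball G S (Suc n)"
  then obtain w where w: "set w \<subseteq> S" "length w \<le> Suc n" "x = word_prod G w"
    by (auto simp: word_ball_def)
  then show "x \<in> insert \<one> (S <#> word_ball G S n)"
    using word_ballI[of "tl w" S n] by (cases w) (auto simp: set_mult_def)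
next
  fix x assume "x \<in> insert \<one> (S <#> word_ball G S n)"
  then consider "x = \<one>" | s w where "s \<in> S" "set w \<subseteq> S" "length w \<le> n" "x = s \<otimes> word_prod G w"
    by (auto simp: set_mult_def word_ball_def)
  then show "x \<in> word_ball G S (Suc n)"
    using word_ballI[of "s # w" S "Suc n" for s w] by cases (auto simp: one_in_word_ball)
qed

text \<open>Every suffix of \<open>w\<close> has length at most \<open>n\<close>, so its value is a
  letter of the ball; the word is collapsed from its right end, one triangle per letter.\<close>

lemma tri_equiv_word_ball:
  assumes "S \<subseteq> carrier G" "1 \<le> n" "set w \<subseteq> S" "length w \<le> n"
  shows "tri_equiv G (word_ball G S n) w [word_prod G w]"
  using assms(3,4)
proof (induction w)
  case Nil
  then show ?case
    using tri_equiv.sym[OF tri_equiv.one[OF one_in_word_ball]] by simp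
next
  case (Cons x w)
  have x: "x \<in> word_ball G S n" using subset_word_ball[OF assms(1,2)] Cons.prems by auto
  have "tri_equiv G (word_ball G S n) (x # w) [x, word_prod G w]"
    using Cons x by (intro tri_equiv_Cons) auto
  also have "tri_equiv G (word_ball G S n) [x, word_prod G w] [x \<otimes> word_prod G w]"
    using Cons.prems x word_ballI[of "x # w" S n] word_ballI[of w S n]
    by (intro tri_equiv.triangle) auto
  finally show ?case by simp
qed

lemma word_ball_word_refine:
  assumes "S \<subseteq> carrier G" "1 \<le> n" "set w \<subseteq> word_ball G S n"
  shows "\<exists>v. set v \<subseteq> S \<and> tri_equiv G (word_ball G S n) w v"
proof -
  have "\<exists>v. set v \<subseteq> S \<and> tri_equiv G (word_ball G S n) [x] (map id v)"
    if "x \<in> word_ball G S n" for x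
  proof -
    obtain v where "set v \<subseteq> S" "length v \<le> n" "x = word_prod G v"
      using \<open>x \<in> word_ball G S n\<close> by (auto simp: word_ball_def)
    then show ?thesis
      using tri_equiv.sym[OF tri_equiv_word_ball[OF assms(1,2)]] by auto
  qed
  from tri_equiv_lift_words[OF this assms(3)] show ?thesis by simp
qed

text \<open>A loop over the ball can be refined to a loop over \<open>S\<close>, so only loops over
  \<open>S\<close> have to be filled, while the filling may use the larger triangles of the
  ball.\<close>

lemma triangularly_presented_word_ball:
  assumes "S \<subseteq> carrier G" "\<And>s. s \<in> S \<Longrightarrow> inv s \<in> S" "1 \<le> n"
    and "\<And>g. g \<in> carrier G \<Longrightarrow> \<exists>w. set w \<subseteq> S \<and> word_prod G w = g"
    and null: "\<And>w. set w \<subseteq> S \<Longrightarrow> word_prod G w = \<one> \<Longrightarrow> tri_equiv G (word_ball G S n) w []"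
  shows "triangularly_presented_by G (word_ball G S n)"
  unfolding triangularly_presented_by_def
proof (intro conjI ballI allI impI)
  fix g assume "g \<in> carrier G"
  then show "\<exists>w. set w \<subseteq> word_ball G S n \<and> word_prod G w = g"
    using assms(4)[of g] subset_word_ball[OF assms(1,3)] by blast
next
  fix w assume w: "set w \<subseteq> word_ball G S n" "word_prod G w = \<one>"
  obtain v where v: "set v \<subseteq> S" "tri_equiv G (word_ball G S n) w v"
    using word_ball_word_refine[OF assms(1,3) w(1)] by blast
  have "word_prod G v = \<one>"
    using tri_equiv_word_prod[OF v(2)] w(2) word_ball_subset_carrier[OF assms(1)] by simp
  then show "tri_equiv G (word_ball G S n) w []"
    using v null tri_equiv.trans by metis
qed (use assms word_ball_subset_carrier word_ball_inv one_in_word_ball in auto)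

lemma triangularly_presented_word_ball_self:
  assumes "triangularly_presented_by G S" "1 \<le> n"
  shows "triangularly_presented_by G (word_ball G S n)"
  using assms subset_word_ball[of S n] unfolding triangularly_presented_by_def[of G S]
  by (intro triangularly_presented_word_ball) (auto intro: tri_equiv_mono)

end

section \<open>Bounded presentations and triangle relations\<close>

context group
begin

definition letter_value :: "'a \<times> bool \<Rightarrow> 'a" where
  "letter_value x = (if snd x then fst x else inv (fst x))"

lemma eval_word_eq_word_prod: "eval_word G w = word_prod G (map letter_value w)"
  by (induction w) (auto simp: eval_word_def letter_value_def)

text \<open>Each cancellation made by \<open>red_cons\<close> is a triangle with sides a letter, its
  inverse and the identity, followed by deletion of the identity.\<close>

lemma tri_equiv_foldr_red_cons:
  assumes one: "\<one> \<in> B" and letter: "\<And>x. x \<in> A \<times> UNIV \<Longrightarrow> letter_value x \<in> B"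
    and A: "A \<subseteq> carrier G" and u: "set u \<subseteq> A \<times> UNIV" and v: "set v \<subseteq> A \<times> UNIV"
  shows "tri_equiv G B (map letter_value (foldr red_cons u v)) (map letter_value (u @ v))"
  using u
proof (induction u)
  case Nil
  then show ?case
    using v letter by (simp add: tri_equiv.refl image_subset_iff subset_eq)
next
  case (Cons x u)
  let ?w = "foldr red_cons u v"
  have x: "letter_value x \<in> B" "fst x \<in> carrier G" using Cons.prems letter A by auto
  have w: "set ?w \<subseteq> A \<times> UNIV" using set_foldr_red_cons[of u v] Cons.prems v by auto
  have wB: "letter_value ` set ?w \<subseteq> B"
    using w letter by (simp add: image_subset_iff subset_eq)
  have "tri_equiv G B (map letter_value (red_cons x ?w)) (letter_value x # map letter_value ?w)"
  proof (cases "?w \<noteq> [] \<and> hd ?w = inv_letter x")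
    case True
    then obtain w' where w': "?w = inv_letter x # w'" by (cases ?w) auto
    have inverse: "letter_value x \<otimes> letter_value (inv_letter x) = \<one>"
      using x(2) by (simp add: letter_value_def inv_letter_def)
    have "letter_value (inv_letter x) \<in> B" "set (map letter_value w') \<subseteq> B"
      using w w' letter by auto
    then have "tri_equiv G B ([letter_value x, letter_value (inv_letter x)] @ map letter_value w')
        ([\<one>] @ map letter_value w')"
      using tri_equiv.triangle[OF x(1), of "letter_value (inv_letter x)" G] one
      by (intro tri_equiv.append tri_equiv.refl) (auto simp: inverse)
    also have "tri_equiv G B ([\<one>] @ map letter_value w') ([] @ map letter_value w')"
      using one \<open>set (map letter_value w') \<subseteq> B\<close>
      by (intro tri_equiv.append tri_equiv.one tri_equiv.refl)
    finally show ?thesis using w' by (simp add: red_cons_def tri_equiv.sym)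
  next
    case False
    then show ?thesis
      using tri_equiv.refl[of "letter_value x # map letter_value ?w" B G] x wB
      by (auto simp: red_cons_def)
  qed
  also have "tri_equiv G B (letter_value x # map letter_value ?w) (map letter_value ((x # u) @ v))"
    using Cons x by (auto intro: tri_equiv_Cons)
  finally show ?case by simp
qed

section \<open>Normal closures and null words in the free group\<close>

lemma normal_closure_subset: "N \<lhd> G \<Longrightarrow> R \<subseteq> N \<Longrightarrow> normal_closure G R \<subseteq> N"
  by (auto simp: normal_closure_def)

lemma subset_normal_closure: "R \<subseteq> normal_closure G R"
  by (auto simp: normal_closure_def)

lemma normal_normal_closure:
  assumes "R \<subseteq> carrier G"
  shows "normal_closure G R \<lhd> G"
proof -
  have "carrier G \<lhd> G" by (simp add: normal_inv_iff subgroup_self)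
  then have "subgroup (normal_closure G R) G"
    unfolding normal_closure_def using assms
    by (intro subgroups_Inter) (auto dest: normal_imp_subgroup)
  then show ?thesis
    by (auto simp: normal_inv_iff normal_closure_def)
qed

text \<open>Being normal, this set contains the normal closure of the relators as soon as it
  contains the relators themselves. This carries fillability from the relators to the whole
  kernel.\<close>

lemma normal_tri_null_words:
  assumes one: "\<one> \<in> B" and letter: "\<And>x. x \<in> A \<times> UNIV \<Longrightarrow> letter_value x \<in> B"
    and A: "A \<subseteq> carrier G"
  shows "{w \<in> carrier (free_group A). tri_equiv G B (map letter_value w) []} \<lhd> free_group A"
    (is "?N \<lhd> ?F")
proof -
  interpret F: group ?F by (rule group_free_group)
  have sub: "set w \<subseteq> A \<times> UNIV" if "w \<in> carrier ?F" for w
    using that by (simp add: free_group_def)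
  have mult: "tri_equiv G B (map letter_value (u \<otimes>\<^bsub>?F\<^esub> v)) (map letter_value u @ map letter_value v)"
    if "u \<in> carrier ?F" "v \<in> carrier ?F" for u v
    using tri_equiv_foldr_red_cons[OF assms sub sub] that by (simp add: free_group_def)
  have refl: "tri_equiv G B (map letter_value w) (map letter_value w)" if "w \<in> carrier ?F" for w
    using sub[OF that] letter by (intro tri_equiv.refl) auto
  have one_F: "\<one>\<^bsub>?F\<^esub> = []" by (simp add: free_group_def)
  have nil: "tri_equiv G B [] []" by (simp add: tri_equiv.refl)
  have cancel: "tri_equiv G B (map letter_value u @ map letter_value (inv\<^bsub>?F\<^esub> u)) []"
    if "u \<in> carrier ?F" for u
    using tri_equiv.sym[OF mult[of u "inv\<^bsub>?F\<^esub> u"]] that by (simp add: one_F)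
  have "subgroup ?N ?F"
  proof (rule F.subgroupI)
    show "?N \<noteq> {}" using F.one_closed nil by (auto simp: one_F)
  next
    fix u assume "u \<in> ?N"
    then have u: "u \<in> carrier ?F" "tri_equiv G B (map letter_value u) []" by auto
    \<comment> \<open>Since \<open>u\<close> is null it may be placed in front of its inverse, and
      the two then cancel.\<close>
    have "tri_equiv G B ([] @ map letter_value (inv\<^bsub>?F\<^esub> u)) (map letter_value u @ map letter_value (inv\<^bsub>?F\<^esub> u))"
      using u by (intro tri_equiv.append tri_equiv.sym[OF u(2)] refl) simp
    then show "inv\<^bsub>?F\<^esub> u \<in> ?N"
      using tri_equiv.trans[OF _ cancel[OF u(1)]] u(1) by simp
  next
    fix u v assume "u \<in> ?N" "v \<in> ?N"
    then show "u \<otimes>\<^bsub>?F\<^esub> v \<in> ?N"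
      using tri_equiv.trans[OF mult[of u v] tri_equiv.append[of G B _ "[]" _ "[]", simplified]] by simp
  qed auto
  moreover have "x \<otimes>\<^bsub>?F\<^esub> u \<otimes>\<^bsub>?F\<^esub> inv\<^bsub>?F\<^esub> x \<in> ?N" if x: "x \<in> carrier ?F" and "u \<in> ?N" for x u
  proof -
    have u: "u \<in> carrier ?F" "tri_equiv G B (map letter_value u) []" using that by auto
    have "tri_equiv G B (map letter_value (x \<otimes>\<^bsub>?F\<^esub> u)) (map letter_value x @ [])"
      using tri_equiv.trans[OF mult[OF x u(1)] tri_equiv.append[OF refl[OF x] u(2)]] .
    then have "tri_equiv G B (map letter_value (x \<otimes>\<^bsub>?F\<^esub> u) @ map letter_value (inv\<^bsub>?F\<^esub> x))
        ((map letter_value x @ []) @ map letter_value (inv\<^bsub>?F\<^esub> x))"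
      using x by (intro tri_equiv.append refl) auto
    then have "tri_equiv G B (map letter_value (x \<otimes>\<^bsub>?F\<^esub> u) @ map letter_value (inv\<^bsub>?F\<^esub> x)) []"
      using tri_equiv.trans[OF _ cancel[OF x]] by simp
    then show ?thesis
      using tri_equiv.trans[OF mult[of "x \<otimes>\<^bsub>?F\<^esub> u" "inv\<^bsub>?F\<^esub> x"]] x u(1) by simp
  qed
  ultimately show ?thesis by (auto simp: F.normal_inv_iff)
qed

text \<open>A relator of length at most \<open>n\<close> spells a loop whose partial products stay
  in a ball, so triangles of that ball fill it; the normal closure then takes care of all other
  loops.\<close>

lemma boundedly_presented_imp_triangularly_presented:
  assumes "boundedly_presented_by G S"
  shows "\<exists>n. triangularly_presented_by G (word_ball G (insert \<one> (S \<union> m_inv G ` S)) n)"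
proof -
  obtain R n where pres: "is_presentation G S R" and len: "\<And>r. r \<in> R \<Longrightarrow> length r \<le> n"
    using assms by (auto simp: boundedly_presented_by_def)
  have S: "S \<subseteq> carrier G" and R: "R \<subseteq> carrier (free_group S)"
    and onto: "eval_word G ` carrier (free_group S) = carrier G"
    and ker: "kernel (free_group S) G (eval_word G) = normal_closure (free_group S) R"
    using pres by (auto simp: is_presentation_def)
  interpret F: group "free_group S" by (rule group_free_group)
  define A where "A = insert \<one> (S \<union> m_inv G ` S)"
  \<comment> \<open>The successor makes the radius positive, so that \<open>B\<close> contains
    \<open>A\<close> even when \<open>n\<close> is 0.\<close>
  define B where "B = word_ball G A (Suc n)"
  have A: "A \<subseteq> carrier G" using S by (auto simp: A_def)
  have AB: "A \<subseteq> B" unfolding B_def using A by (intro subset_word_ball) auto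
  have one: "\<one> \<in> B" using one_in_word_ball by (simp add: B_def)
  have letterA: "letter_value x \<in> A" if "x \<in> S \<times> UNIV" for x
    using that by (auto simp: letter_value_def A_def)
  then have letter: "letter_value x \<in> B" if "x \<in> S \<times> UNIV" for x
    using that AB by blast
  have "triangularly_presented_by G (word_ball G A (Suc n))"
  proof (rule triangularly_presented_word_ball)
    fix g assume "g \<in> carrier G"
    then obtain w where "w \<in> carrier (free_group S)" "g = eval_word G w" using onto by auto
    then show "\<exists>w. set w \<subseteq> A \<and> word_prod G w = g"
      using letterA by (intro exI[of _ "map letter_value w"])
        (auto simp: eval_word_eq_word_prod free_group_def)
  next
    fix w assume w: "set w \<subseteq> A" "word_prod G w = \<one>"
    have "\<exists>v. set v \<subseteq> S \<times> UNIV \<and> tri_equiv G B [x] (map letter_value v)" if "x \<in> A" for x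
    proof -
      consider "x = \<one>" | s where "s \<in> S" "x = s" | s where "s \<in> S" "x = inv s"
        using \<open>x \<in> A\<close> by (auto simp: A_def)
      then show ?thesis
      proof cases
        case 1
        then show ?thesis using one by (intro exI[of _ "[]"]) (auto intro: tri_equiv.one)
      next
        case 2
        then show ?thesis
          using AB that
          by (intro exI[of _ "[(s, True)]"]) (auto simp: letter_value_def intro!: tri_equiv.refl)
      next
        case 3
        then show ?thesis
          using AB that
          by (intro exI[of _ "[(s, False)]"]) (auto simp: letter_value_def intro!: tri_equiv.refl)
      qed
    qed
    from tri_equiv_lift_words[OF this w(1)] obtain v
      where v: "set v \<subseteq> S \<times> UNIV" "tri_equiv G B w (map letter_value v)" by blast
    \<comment> \<open>Only reduced words are elements of the free group; reducing \<open>v\<close>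
      does not change its class.\<close>
    let ?r = "foldr red_cons v []"
    have vr: "tri_equiv G B (map letter_value ?r) (map letter_value v)"
      using tri_equiv_foldr_red_cons[OF one letter S v(1), of "[]"] by simp
    have wr: "tri_equiv G B w (map letter_value ?r)"
      using tri_equiv.trans[OF v(2) tri_equiv.sym[OF vr]] .
    have "?r \<in> carrier (free_group S)"
      using set_foldr_red_cons[of v "[]"] v(1) by (auto simp: free_group_def reduced_foldr_red_cons)
    moreover have "eval_word G ?r = \<one>"
      using tri_equiv_word_prod[OF wr] w(2) word_ball_subset_carrier[OF A]
      by (simp add: B_def eval_word_eq_word_prod)
    ultimately have "?r \<in> normal_closure (free_group S) R"
      by (simp add: kernel_def flip: ker)
    also have "\<dots> \<subseteq> {w \<in> carrier (free_group S). tri_equiv G B (map letter_value w) []}"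
    proof (rule F.normal_closure_subset[OF normal_tri_null_words[OF one letter S]])
      show "R \<subseteq> {w \<in> carrier (free_group S). tri_equiv G B (map letter_value w) []}"
      proof (intro subsetI CollectI conjI)
        fix r assume r: "r \<in> R"
        then have rF: "r \<in> carrier (free_group S)" using R by blast
        have "r \<in> kernel (free_group S) G (eval_word G)"
          using r F.subset_normal_closure[of R] by (auto simp: ker)
        then have "word_prod G (map letter_value r) = \<one>"
          by (simp add: kernel_def eval_word_eq_word_prod)
        moreover have "tri_equiv G B (map letter_value r) [word_prod G (map letter_value r)]"
          unfolding B_def using rF letterA len[OF r]
          by (intro tri_equiv_word_ball[OF A]) (auto simp: free_group_def)
        ultimately show "tri_equiv G B (map letter_value r) []"
          using tri_equiv.trans[OF _ tri_equiv.one[OF one]] by simp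
        show "r \<in> carrier (free_group S)" by (fact rF)
      qed
    qed
    finally show "tri_equiv G (word_ball G A (Suc n)) w []"
      using tri_equiv.trans[OF wr] by (simp add: B_def)
  qed (use A S in \<open>auto simp: A_def\<close>)
  then show ?thesis unfolding A_def by blast
qed

text \<open>In the quotient of the free group by the short relators, the generators satisfy all
  triangle relations, so equivalent words have the same image.\<close>

lemma triangularly_presented_imp_boundedly_presented:
  assumes "triangularly_presented_by G S"
  shows "boundedly_presented_by G S"
proof -
  have S: "S \<subseteq> carrier G" and one: "\<one> \<in> S" and inv: "\<And>s. s \<in> S \<Longrightarrow> inv s \<in> S"
    and gen: "\<And>g. g \<in> carrier G \<Longrightarrow> \<exists>w. set w \<subseteq> S \<and> word_prod G w = g"
    and null: "\<And>w. set w \<subseteq> S \<Longrightarrow> word_prod G w = \<one> \<Longrightarrow> tri_equiv G S w []"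
    using assms by (auto simp: triangularly_presented_by_def)
  let ?F = "free_group S"
  interpret F: group ?F by (rule group_free_group)
  interpret eval: group_hom ?F G "eval_word G"
    using eval_word_hom[OF S] by unfold_locales
  define R where "R = {w \<in> kernel ?F G (eval_word G). length w \<le> 3}"
  define N where "N = normal_closure ?F R"
  have R: "R \<subseteq> carrier ?F" by (auto simp: R_def kernel_def)
  have N: "N \<lhd> ?F" unfolding N_def by (rule F.normal_normal_closure[OF R])
  interpret N: normal N ?F by (rule N)
  interpret Q: group "?F Mod N" by (rule N.factorgroup_is_group)
  define \<pi> where "\<pi> w = N #>\<^bsub>?F\<^esub> w" for w
  interpret \<pi>: group_hom ?F "?F Mod N" \<pi>
    unfolding \<pi>_def using N.r_coset_hom_Mod by unfold_locales
  have \<pi>_one: "w \<in> N" if "\<pi> w = \<one>\<^bsub>?F Mod N\<^esub>" "w \<in> carrier ?F" for w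
    using that F.rcos_self[OF that(2) N.subgroup_axioms] by (simp add: \<pi>_def FactGroup_def)
  have \<pi>_N: "\<pi> w = \<one>\<^bsub>?F Mod N\<^esub>" if "w \<in> N" for w
    using N.rcos_const[OF F.group_axioms that] by (simp add: \<pi>_def FactGroup_def)
  note mult_FactGroup [simp del] one_FactGroup [simp del]
  define \<phi> where "\<phi> s = \<pi> [(s, True)]" for s
  have letter: "[x] \<in> carrier ?F" if "x \<in> S \<times> UNIV" for x
    using that by (auto simp: free_group_def reduced_Cons)
  have \<phi>: "\<phi> s \<in> carrier (?F Mod N)" if "s \<in> S" for s
    using \<pi>.hom_closed letter that by (simp add: \<phi>_def)
  have inverse: "[(s, True)] \<otimes>\<^bsub>?F\<^esub> [(s, False)] = \<one>\<^bsub>?F\<^esub>" for s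
    by (simp add: free_group_def red_cons_def inv_letter_def)
  have \<pi>_inverse: "\<phi> s \<otimes>\<^bsub>?F Mod N\<^esub> \<pi> [(s, False)] = \<one>\<^bsub>?F Mod N\<^esub>" if "s \<in> S" for s
    using \<pi>.hom_mult[OF letter letter, of "(s, True)" "(s, False)"] that
    by (simp add: inverse \<phi>_def)
  have \<phi>_mult: "\<phi> x \<otimes>\<^bsub>?F Mod N\<^esub> \<phi> y = \<phi> (x \<otimes> y)" if "x \<in> S" "y \<in> S" "x \<otimes> y \<in> S" for x y
  proof -
    \<comment> \<open>The product is taken in the free group because the plain list need not be
      reduced: for \<open>x = \<one>\<close> its last two letters cancel.\<close>
    let ?r = "[(x, True)] \<otimes>\<^bsub>?F\<^esub> ([(y, True)] \<otimes>\<^bsub>?F\<^esub> [(x \<otimes> y, False)])"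
    have F: "[(x, True)] \<in> carrier ?F" "[(y, True)] \<in> carrier ?F" "[(x \<otimes> y, False)] \<in> carrier ?F"
      using that by (auto intro: letter)
    have "x \<in> carrier G" "y \<in> carrier G" using that S by auto
    moreover have "eval_word G ?r = eval_word G [(x, True)] \<otimes>
        (eval_word G [(y, True)] \<otimes> eval_word G [(x \<otimes> y, False)])"
      using F by simp
    ultimately have "eval_word G ?r = \<one>"
      by (simp add: eval_word_eq_word_prod letter_value_def inv_mult_group mult_inv_cancel_left)
    moreover have "length ?r \<le> 3" by (auto simp: free_group_def red_cons_def)
    ultimately have "?r \<in> R"
      using F.m_closed[OF F(1) F.m_closed[OF F(2,3)]] by (simp add: R_def kernel_def)
    then have "?r \<in> N"
      using F.subset_normal_closure unfolding N_def by (rule subsetD[rotated])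
    from \<pi>_N[OF this]
    have *: "\<phi> x \<otimes>\<^bsub>?F Mod N\<^esub> \<phi> y \<otimes>\<^bsub>?F Mod N\<^esub> \<pi> [(x \<otimes> y, False)] = \<one>\<^bsub>?F Mod N\<^esub>"
      using F by (simp add: \<phi>_def Q.m_assoc)
    have "\<phi> x \<otimes>\<^bsub>?F Mod N\<^esub> \<phi> y \<in> carrier (?F Mod N)"
      using \<phi>[OF that(1)] \<phi>[OF that(2)] by (rule Q.m_closed)
    with \<phi>[OF that(3)] \<pi>.hom_closed[OF F(3)] show ?thesis
      using * \<pi>_inverse[OF that(3)] Q.r_cancel by metis
  qed
  have \<pi>_word: "\<pi> w = word_prod (?F Mod N) (map \<phi> (map letter_value w))" if "w \<in> carrier ?F" for w
    using that
  proof (induction w)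
    case Nil
    then show ?case using \<pi>.hom_one by (simp add: free_group_def)
  next
    case (Cons x w)
    have w: "w \<in> carrier ?F" and x: "fst x \<in> S" and split: "x # w = [x] \<otimes>\<^bsub>?F\<^esub> w"
      using Cons.prems by (auto simp: free_group_def reduced_Cons red_cons_def)
    have "\<pi> [x] = \<phi> (letter_value x)"
    proof (cases "snd x")
      case True
      then show ?thesis by (cases x) (simp add: \<phi>_def letter_value_def)
    next
      case False
      let ?s = "fst x"
      have x_eq: "x = (?s, False)" using False by (cases x) simp
      have s: "?s \<in> carrier G" using x S by blast
      have "\<phi> \<one> = \<one>\<^bsub>?F Mod N\<^esub>"
        using \<phi>_mult[of \<one> \<one>] one \<phi>[OF one] by simp
      \<comment> \<open>The generator \<open>inv ?s\<close> and the formal inverse of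
        \<open>?s\<close> have the same image, since both images are right inverses of
        \<open>\<phi> ?s\<close>.\<close>
      then have "\<phi> ?s \<otimes>\<^bsub>?F Mod N\<^esub> \<phi> (inv ?s) = \<phi> ?s \<otimes>\<^bsub>?F Mod N\<^esub> \<pi> [x]"
        using \<phi>_mult[of ?s "inv ?s"] \<pi>_inverse[OF x] x s one inv x_eq by simp
      then show ?thesis
        using Q.l_cancel[of "\<phi> ?s" "\<phi> (inv ?s)" "\<pi> [x]"] \<phi> x inv False
          \<pi>.hom_closed[OF letter[of x]] x_eq
        by (simp add: letter_value_def mem_Times_iff)
    qed
    moreover have "\<pi> (x # w) = \<pi> [x] \<otimes>\<^bsub>?F Mod N\<^esub> \<pi> w"
      using \<pi>.hom_mult[OF letter w, of x] x by (simp add: split mem_Times_iff)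
    ultimately show ?case using Cons.IH[OF w] by simp
  qed
  have "kernel ?F G (eval_word G) = N"
  proof
    show "kernel ?F G (eval_word G) \<subseteq> N"
    proof
      fix w assume "w \<in> kernel ?F G (eval_word G)"
      then have w: "w \<in> carrier ?F" "word_prod G (map letter_value w) = \<one>"
        by (auto simp: kernel_def eval_word_eq_word_prod)
      have "set (map letter_value w) \<subseteq> S"
        using w(1) inv by (auto simp: free_group_def letter_value_def)
      from tri_equiv_word_prod_hom[OF null[OF this w(2)] Q.group_axioms \<phi> \<phi>_mult]
      show "w \<in> N" using \<pi>_word[OF w(1)] w(1) by (intro \<pi>_one) auto
    qed
    show "N \<subseteq> kernel ?F G (eval_word G)"
      unfolding N_def by (rule F.normal_closure_subset[OF eval.normal_kernel]) (auto simp: R_def)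
  qed
  moreover have "eval_word G ` carrier ?F = carrier G"
  proof
    show "carrier G \<subseteq> eval_word G ` carrier ?F"
    proof
      fix g assume "g \<in> carrier G"
      then obtain w where w: "set w \<subseteq> S" "word_prod G w = g" using gen by blast
      have "word_prod G w \<in> eval_word G ` carrier ?F"
        using w(1)
      proof (induction w)
        case Nil
        show ?case using eval.hom_one F.one_closed by (metis imageI word_prod_simps(1))
      next
        case (Cons s w)
        then obtain v where v: "v \<in> carrier ?F" "word_prod G w = eval_word G v" by auto
        have s: "[(s, True)] \<in> carrier ?F" "s \<in> carrier G" using Cons.prems S letter by auto
        then have "word_prod G (s # w) = eval_word G ([(s, True)] \<otimes>\<^bsub>?F\<^esub> v)"
          using v by (simp add: eval_word_generator)
        then show ?case using s v by blast
      qed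
      then show "g \<in> eval_word G ` carrier ?F" using w by simp
    qed
  qed auto
  ultimately have "is_presentation G S R"
    using S R by (simp add: is_presentation_def N_def)
  then show ?thesis
    by (auto simp: boundedly_presented_by_def R_def intro!: exI[of _ R] exI[of _ 3])
qed

end

section \<open>Word balls in locally compact groups\<close>

context topological_group
begin

lemma compactin_set_mult:
  assumes "compactin T A" "compactin T B"
  shows "compactin T (A <#> B)"
proof -
  have "compactin T ((\<lambda>(x, y). x \<otimes> y) ` (A \<times> B))"
    using continuous_mult assms by (intro image_compactin) (auto simp: compactin_Times)
  moreover have "(\<lambda>(x, y). x \<otimes> y) ` (A \<times> B) = A <#> B"
    by (auto simp: set_mult_def)
  ultimately show ?thesis by simp
qed

lemma compactin_m_inv_image: "compactin T A \<Longrightarrow> compactin T (m_inv G ` A)"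
  using continuous_inv by (rule image_compactin[rotated])

lemma compactin_insert_one: "compactin T A \<Longrightarrow> compactin T (insert \<one> A)"
  using compactin_Un[of T "{\<one>}" A] by (simp add: topspace_eq)

lemma compactin_subset_carrier: "compactin T A \<Longrightarrow> A \<subseteq> carrier G"
  using compactin_subset_topspace topspace_eq by metis

lemma compactin_word_ball:
  assumes "compactin T S"
  shows "compactin T (word_ball G S n)"
proof (induction n)
  case 0
  have "word_ball G S 0 = {\<one>}" by (auto simp: word_ball_def)
  then show ?case by (simp add: topspace_eq)
next
  case (Suc n)
  then show ?case
    using assms by (simp add: word_ball_Suc compactin_insert_one compactin_set_mult)
qed

text \<open>The triangular presentation obtained from a bounded one lives on a ball of the
  symmetrized generating set, and symmetrizing, adding the identity and forming balls all preserve
  compactness.\<close>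

lemma compactly_presented_iff:
  "compactly_presented G T \<longleftrightarrow>
    Hausdorff_space T \<and> (\<exists>S. compactin T S \<and> triangularly_presented_by G S)"
proof -
  have "\<exists>S. compactin T S \<and> triangularly_presented_by G S"
    if "compactin T S" "boundedly_presented_by G S" for S
    using boundedly_presented_imp_triangularly_presented[OF that(2)] that(1)
      compactin_word_ball compactin_insert_one compactin_Un compactin_m_inv_image by metis
  then show ?thesis
    using triangularly_presented_imp_boundedly_presented
    by (auto simp: compactly_presented_def)
qed

text \<open>By the Baire category theorem some word ball has an interior point; finitely many of its
  translates cover any compact set.\<close>

lemma compactin_subset_word_ball:
  assumes "Hausdorff_space T" "locally_compact_space T" and S: "compactin T S"
    and gen: "\<And>g. g \<in> carrier G \<Longrightarrow> \<exists>w. set w \<subseteq> S \<and> word_prod G w = g"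
    and C: "compactin T C"
  obtains n where "1 \<le> n" "C \<subseteq> word_ball G S n"
proof -
  note S_carrier = compactin_subset_carrier[OF S]
  have ball: "\<exists>n. g \<in> word_ball G S n" if "g \<in> carrier G" for g
    using gen[OF that] word_ballI by blast
  have "\<exists>n. T interior_of word_ball G S n \<noteq> {}"
  proof (rule ccontr)
    assume "\<nexists>n. T interior_of word_ball G S n \<noteq> {}"
    then have "T interior_of \<Union>(range (word_ball G S)) = {}"
      using assms(1,2) compactin_imp_closedin[OF assms(1) compactin_word_ball[OF S]]
        locally_compact_Hausdorff_imp_regular_space[OF assms(2,1)]
      by (intro Baire_category_alt) auto
    moreover have "\<Union>(range (word_ball G S)) = topspace T"
      using ball word_ball_subset_carrier[OF S_carrier] by (auto simp: topspace_eq)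
    ultimately show False using one_closed topspace_eq by (metis empty_iff interior_of_topspace)
  qed
  then obtain n where "T interior_of word_ball G S n \<noteq> {}" by (rule exE)
  then obtain u where u: "u \<in> T interior_of word_ball G S n" by (meson all_not_in_conv)
  define U where "U = T interior_of word_ball G S n"
  have uG: "u \<in> carrier G"
    using u interior_of_subset_topspace[of T "word_ball G S n"] topspace_eq by auto
  \<comment> \<open>The preimage of \<open>U\<close> under the left translation that moves
    \<open>c\<close> to \<open>u\<close>, hence an open neighbourhood of \<open>c\<close>.\<close>
  define V where "V c = {x \<in> topspace T. (u \<otimes> inv c) \<otimes> x \<in> U}" for c
  have C_carrier: "C \<subseteq> carrier G" by (rule compactin_subset_carrier[OF C])
  have V_open: "openin T (V c)" if "c \<in> C" for c
  proof -
    have "u \<otimes> inv c \<in> topspace T" using that C_carrier uG topspace_eq by auto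
    then have "continuous_map T (prod_topology T T) (\<lambda>x. (u \<otimes> inv c, x))"
      by (intro continuous_map_pairedI) auto
    from continuous_map_compose[OF this continuous_mult]
    have "continuous_map T T (\<lambda>x. (u \<otimes> inv c) \<otimes> x)" by (simp add: o_def)
    then show ?thesis
      unfolding V_def U_def by (rule openin_continuous_map_preimage) simp
  qed
  have "c \<in> V c" if "c \<in> C" for c
    using that C_carrier uG u by (auto simp: V_def U_def topspace_eq m_assoc)
  then obtain \<F> where \<F>: "finite \<F>" "\<F> \<subseteq> V ` C" "C \<subseteq> \<Union>\<F>"
    using compactinD[OF C, of "V ` C"] V_open by blast
  obtain C0 where C0: "C0 \<subseteq> C" "finite C0" "\<F> = V ` C0"
    using finite_subset_image[OF \<F>(1,2)] by blast
  have "\<exists>m. c \<otimes> inv u \<in> word_ball G S m" if "c \<in> C" for c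
    using that C_carrier uG by (intro ball) auto
  then obtain m where m: "\<And>c. c \<in> C \<Longrightarrow> c \<otimes> inv u \<in> word_ball G S (m c)" by metis
  \<comment> \<open>The finite sum dominates each \<open>m c\<close> with \<open>c\<close> in
    \<open>C0\<close>; the successor guarantees a radius of at least 1.\<close>
  have "C \<subseteq> word_ball G S (Suc (sum m C0 + n))"
  proof
    fix x assume x: "x \<in> C"
    then obtain c where c: "c \<in> C0" "x \<in> V c" using \<F>(3) C0(3) by auto
    have cG: "c \<in> carrier G" "x \<in> carrier G" using c(1) C0(1) x C_carrier by auto
    have "(c \<otimes> inv u) \<otimes> ((u \<otimes> inv c) \<otimes> x) \<in> word_ball G S (m c + n)"
      using m[of c] c C0(1) interior_of_subset[of T "word_ball G S n"]
      by (intro word_ball_mult[OF S_carrier]) (auto simp: V_def U_def)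
    also have "(c \<otimes> inv u) \<otimes> ((u \<otimes> inv c) \<otimes> x) = x"
      using cG uG by (simp add: m_assoc mult_inv_cancel_left)
    also have "word_ball G S (m c + n) \<subseteq> word_ball G S (Suc (sum m C0 + n))"
      using member_le_sum[of c C0 m] c(1) C0(2) by (intro word_ball_mono) auto
    finally show "x \<in> word_ball G S (Suc (sum m C0 + n))" .
  qed
  then show ?thesis by (intro that) auto
qed

lemma topological_group_subgroup:
  assumes "subgroup H G"
  shows "topological_group (G\<lparr>carrier := H\<rparr>) (subtopology T H)"
proof -
  interpret H: group "G\<lparr>carrier := H\<rparr>" using subgroup.subgroup_is_group[OF assms] group_axioms by blast
  have sub: "H \<subseteq> carrier G" by (rule subgroup.subset[OF assms])
  have top: "topspace (subtopology T H) = H" using sub by (auto simp: topspace_eq)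
  have "continuous_map (subtopology (prod_topology T T) (H \<times> H)) (subtopology T H) (\<lambda>(x, y). x \<otimes> y)"
    using assms
    by (intro continuous_map_into_subtopology continuous_map_from_subtopology continuous_mult)
      (auto intro: subgroup.m_closed)
  moreover have "continuous_map (subtopology T H) (subtopology T H) (\<lambda>x. inv x)"
    using assms
    by (intro continuous_map_into_subtopology continuous_map_from_subtopology continuous_inv)
      (auto intro: subgroup.m_inv_closed)
  then have "continuous_map (subtopology T H) (subtopology T H) (\<lambda>x. inv\<^bsub>G\<lparr>carrier := H\<rparr>\<^esub> x)"
    by (rule continuous_map_eq) (simp add: top m_inv_consistent[OF assms])
  ultimately show ?thesis
    using top by unfold_locales (auto simp: subtopology_Times)
qed

end

section \<open>Transport along coarse maps\<close>

text \<open>If \<open>w\<close> is read as the path in \<open>G\<close> that starts at \<open>g\<close> and has the letters of \<open>w\<close> as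
  increments, then \<open>transport_word G f g w\<close> is the list of increments of the image path under \<open>f\<close>.\<close>

primrec transport_word ::
    "('a, 'b) monoid_scheme \<Rightarrow> ('a \<Rightarrow> 'a) \<Rightarrow> 'a \<Rightarrow> 'a list \<Rightarrow> 'a list" where
  "transport_word G f g [] = []"
| "transport_word G f g (s # w) =
     (inv\<^bsub>G\<^esub> (f g) \<otimes>\<^bsub>G\<^esub> f (g \<otimes>\<^bsub>G\<^esub> s)) # transport_word G f (g \<otimes>\<^bsub>G\<^esub> s) w"

context group
begin

lemma transport_word_append:
  assumes "g \<in> carrier G" "set u \<subseteq> carrier G" "set v \<subseteq> carrier G"
  shows "transport_word G f g (u @ v) =
    transport_word G f g u @ transport_word G f (g \<otimes> word_prod G u) v"
  using assms by (induction u arbitrary: g) (auto simp: m_assoc)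

text \<open>The increments along the image path telescope to the difference of its
  endpoints.\<close>

lemma word_prod_transport_word:
  assumes "\<And>g. g \<in> carrier G \<Longrightarrow> f g \<in> carrier G" "g \<in> carrier G" "set w \<subseteq> carrier G"
  shows "word_prod G (transport_word G f g w) = inv (f g) \<otimes> f (g \<otimes> word_prod G w)"
  using assms(2,3)
proof (induction w arbitrary: g)
  case (Cons s w)
  then have "f g \<in> carrier G" "f (g \<otimes> s) \<in> carrier G" "f (g \<otimes> (s \<otimes> word_prod G w)) \<in> carrier G"
    using assms(1) by auto
  then show ?case using Cons by (simp add: m_assoc mult_inv_cancel_left)
qed (use assms(1) in simp)

lemma set_transport_word_subset:
  assumes "\<And>g s. g \<in> carrier G \<Longrightarrow> s \<in> S \<Longrightarrow> inv (f g) \<otimes> f (g \<otimes> s) \<in> B"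
    and "S \<subseteq> carrier G" "g \<in> carrier G" "set w \<subseteq> S"
  shows "set (transport_word G f g w) \<subseteq> B"
  using assms(3,4)
proof (induction w arbitrary: g)
  case (Cons s w)
  then have "g \<otimes> s \<in> carrier G" using assms(2) by auto
  then show ?case using Cons assms(1) by simp
qed simp

lemma transport_word_fixed:
  assumes "subgroup H G" "\<And>h. h \<in> H \<Longrightarrow> f h = h" "h \<in> H" "set w \<subseteq> H"
  shows "transport_word G f h w = w"
  using assms(3,4)
proof (induction w arbitrary: h)
  case (Cons s w)
  interpret H: subgroup H G by fact
  have "h \<otimes> s \<in> H" "h \<in> carrier G" "s \<in> carrier G" using Cons.prems by auto
  then show ?case using Cons assms(2) by (simp add: m_assoc[symmetric])
qed simp

text \<open>A triangle at \<open>g\<close> goes to the triangle with corners \<open>f g\<close>,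
  \<open>f (g \<otimes> x)\<close> and \<open>f (g \<otimes> x \<otimes> y)\<close>, whose sides are
  increments and so lie in \<open>B\<close>. Under concatenation the second pieces start at a common
  vertex because equivalent words have equal values.\<close>

lemma tri_equiv_transport_word:
  assumes "tri_equiv G S u v" "S \<subseteq> carrier G" "\<And>g. g \<in> carrier G \<Longrightarrow> f g \<in> carrier G"
    and B: "\<And>g s. g \<in> carrier G \<Longrightarrow> s \<in> S \<Longrightarrow> inv (f g) \<otimes> f (g \<otimes> s) \<in> B"
    and "g \<in> carrier G"
  shows "tri_equiv G B (transport_word G f g u) (transport_word G f g v)"
  using assms(1,5)
proof (induction arbitrary: g rule: tri_equiv.induct)
  case (refl w)
  then show ?case
    using set_transport_word_subset[OF B assms(2)] by (intro tri_equiv.refl)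
next
  case (append u u' v v')
  have "set u \<subseteq> carrier G" "set u' \<subseteq> carrier G" "set v \<subseteq> carrier G" "set v' \<subseteq> carrier G"
    using tri_equiv_set[OF append.hyps(1)] tri_equiv_set[OF append.hyps(2)] assms(2) by auto
  then show ?case
    using append tri_equiv_word_prod[OF append.hyps(1) assms(2)]
    by (auto simp: transport_word_append intro!: tri_equiv.append)
next
  case (triangle x y)
  have G: "x \<in> carrier G" "y \<in> carrier G" using triangle assms(2) by auto
  have "(inv (f g) \<otimes> f (g \<otimes> x)) \<otimes> (inv (f (g \<otimes> x)) \<otimes> f (g \<otimes> x \<otimes> y)) =
      inv (f g) \<otimes> f (g \<otimes> (x \<otimes> y))"
    using G triangle.prems assms(3) by (simp add: m_assoc mult_inv_cancel_left)
  then show ?case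
    using tri_equiv.triangle[of "inv (f g) \<otimes> f (g \<otimes> x)" B "inv (f (g \<otimes> x)) \<otimes> f (g \<otimes> x \<otimes> y)" G]
      B[OF triangle.prems triangle.hyps(1)] B[OF triangle.prems triangle.hyps(3)]
      B[of "g \<otimes> x" y] triangle G by simp
next
  case one
  then show ?case
    using B[of g \<one>] assms(3) by (auto intro: tri_equiv.one)
qed (auto intro: tri_equiv.sym tri_equiv.trans)

text \<open>The strip between a path and its image under \<open>f\<close>, cut into triangles.\<close>

lemma tri_equiv_transport_word_conjugate:
  assumes S: "S \<subseteq> carrier G" "S \<subseteq> B" and f: "\<And>g. g \<in> carrier G \<Longrightarrow> f g \<in> carrier G"
    and q: "\<And>g. g \<in> carrier G \<Longrightarrow> inv (f g) \<otimes> g \<in> B"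
    and d: "\<And>g s. g \<in> carrier G \<Longrightarrow> s \<in> S \<Longrightarrow> inv (f g) \<otimes> (g \<otimes> s) \<in> B"
    and B: "\<And>g s. g \<in> carrier G \<Longrightarrow> s \<in> S \<Longrightarrow> inv (f g) \<otimes> f (g \<otimes> s) \<in> B"
    and "g \<in> carrier G" "set w \<subseteq> S"
  shows "tri_equiv G B ((inv (f g) \<otimes> g) # w)
    (transport_word G f g w @ [inv (f (g \<otimes> word_prod G w)) \<otimes> (g \<otimes> word_prod G w)])"
  using assms(7,8)
proof (induction w arbitrary: g)
  case Nil
  then show ?case using q by (simp add: tri_equiv.refl)
next
  case (Cons s w)
  have s: "s \<in> S" "s \<in> carrier G" "g \<otimes> s \<in> carrier G" using Cons.prems S by auto
  have "set w \<subseteq> carrier G" using Cons.prems S by auto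
  have fg: "f g \<in> carrier G" "f (g \<otimes> s) \<in> carrier G" using f s Cons.prems by auto
  have w: "tri_equiv G B w w" using Cons.prems S by (intro tri_equiv.refl) auto
  have e1: "(inv (f g) \<otimes> g) \<otimes> s = inv (f g) \<otimes> (g \<otimes> s)"
    using s fg Cons.prems by (simp add: m_assoc)
  have e2: "(inv (f g) \<otimes> f (g \<otimes> s)) \<otimes> (inv (f (g \<otimes> s)) \<otimes> (g \<otimes> s)) = inv (f g) \<otimes> (g \<otimes> s)"
    using s fg Cons.prems by (simp add: m_assoc mult_inv_cancel_left)
  \<comment> \<open>The square with corners \<open>f g\<close>, \<open>g\<close>,
    \<open>g \<otimes> s\<close> and \<open>f (g \<otimes> s)\<close> is cut along the diagonal from
    \<open>f g\<close> to \<open>g \<otimes> s\<close>.\<close>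
  have "tri_equiv G B [inv (f g) \<otimes> g, s] [inv (f g) \<otimes> (g \<otimes> s)]"
    using tri_equiv.triangle[of "inv (f g) \<otimes> g" B s G] q d s S Cons.prems by (auto simp: e1)
  also have "tri_equiv G B [inv (f g) \<otimes> (g \<otimes> s)]
      [inv (f g) \<otimes> f (g \<otimes> s), inv (f (g \<otimes> s)) \<otimes> (g \<otimes> s)]"
    using tri_equiv.triangle[of "inv (f g) \<otimes> f (g \<otimes> s)" B "inv (f (g \<otimes> s)) \<otimes> (g \<otimes> s)" G]
      q[OF s(3)] d[of g s] B[of g s] s Cons.prems by (auto simp: e2 intro: tri_equiv.sym)
  finally have "tri_equiv G B ([inv (f g) \<otimes> g, s] @ w)
      ([inv (f g) \<otimes> f (g \<otimes> s), inv (f (g \<otimes> s)) \<otimes> (g \<otimes> s)] @ w)"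
    using w by (rule tri_equiv.append)
  moreover have "tri_equiv G B ([inv (f g) \<otimes> f (g \<otimes> s)] @ ((inv (f (g \<otimes> s)) \<otimes> (g \<otimes> s)) # w))
      ([inv (f g) \<otimes> f (g \<otimes> s)] @ transport_word G f (g \<otimes> s) w @
        [inv (f (g \<otimes> s \<otimes> word_prod G w)) \<otimes> (g \<otimes> s \<otimes> word_prod G w)])"
    using Cons B[of g s] s by (intro tri_equiv.append tri_equiv.refl Cons.IH) auto
  ultimately have "tri_equiv G B ((inv (f g) \<otimes> g) # s # w)
      ([inv (f g) \<otimes> f (g \<otimes> s)] @ transport_word G f (g \<otimes> s) w @
        [inv (f (g \<otimes> s \<otimes> word_prod G w)) \<otimes> (g \<otimes> s \<otimes> word_prod G w)])"
    using tri_equiv.trans by fastforce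
  then show ?case
    using \<open>set w \<subseteq> carrier G\<close> s Cons.prems by (simp add: m_assoc)
qed

text \<open>Sending \<open>g = h \<otimes> k\<close> to \<open>h\<close> need not fix
  \<open>H\<close>; choosing \<open>f g = g\<close> on \<open>H\<close> repairs this at the price of
  adding the identity to \<open>K\<close>.\<close>

lemma subgroup_retraction:
  assumes "subgroup H G" "K \<subseteq> carrier G" "carrier G = H <#> K"
  obtains f where "\<And>g. g \<in> carrier G \<Longrightarrow> f g \<in> H" "\<And>h. h \<in> H \<Longrightarrow> f h = h"
    "\<And>g. g \<in> carrier G \<Longrightarrow> inv (f g) \<otimes> g \<in> insert \<one> K"
proof -
  interpret H: subgroup H G by fact
  have "\<exists>h. h \<in> H \<and> (g \<in> H \<longrightarrow> h = g) \<and> inv h \<otimes> g \<in> insert \<one> K" if "g \<in> carrier G" for g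
  proof (cases "g \<in> H")
    case True
    then show ?thesis by (intro exI[of _ g]) simp
  next
    case False
    obtain h k where hk: "h \<in> H" "k \<in> K" "g = h \<otimes> k"
      using \<open>g \<in> carrier G\<close> assms(3) by (auto simp: set_mult_def)
    then have "inv h \<otimes> g = k" using assms(2) by (auto simp: m_assoc[symmetric])
    then show ?thesis using hk False by blast
  qed
  then obtain f where
    "\<And>g. g \<in> carrier G \<Longrightarrow> f g \<in> H \<and> (g \<in> H \<longrightarrow> f g = g) \<and> inv (f g) \<otimes> g \<in> insert \<one> K"
    by metis
  then show ?thesis by (intro that[of f]) (auto dest: H.mem_carrier)
qed

text \<open>Go from \<open>f g\<close> to \<open>f (g \<otimes> s)\<close> by way of
  \<open>g\<close> and \<open>g \<otimes> s\<close>: the first leg is in \<open>K\<close>, the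
  second is \<open>s\<close>, the third is the inverse of an element of \<open>K\<close>.\<close>

lemma retraction_increment:
  assumes H: "subgroup H G" and f: "\<And>g. g \<in> carrier G \<Longrightarrow> f g \<in> H"
    and q: "\<And>g. g \<in> carrier G \<Longrightarrow> inv (f g) \<otimes> g \<in> K"
    and "g \<in> carrier G" "s \<in> S" "S \<subseteq> carrier G"
  shows "inv (f g) \<otimes> f (g \<otimes> s) \<in> (K <#> S <#> m_inv G ` K) \<inter> H"
proof
  interpret H: subgroup H G by fact
  have s: "s \<in> carrier G" "g \<otimes> s \<in> carrier G" using assms by auto
  have fs: "f g \<in> carrier G" "f (g \<otimes> s) \<in> carrier G" using f s assms(4) by auto
  have "inv (f g) \<otimes> f (g \<otimes> s) =
      (inv (f g) \<otimes> g) \<otimes> s \<otimes> inv (inv (f (g \<otimes> s)) \<otimes> (g \<otimes> s))"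
    using s fs assms(4) by (simp add: inv_mult_group m_assoc mult_inv_cancel_left)
  then show "inv (f g) \<otimes> f (g \<otimes> s) \<in> K <#> S <#> m_inv G ` K"
    using q[OF assms(4)] q[OF s(2)] assms(5) by (auto simp: set_mult_def)
  show "inv (f g) \<otimes> f (g \<otimes> s) \<in> H"
    using f s assms(4) by simp
qed

lemma inv_mem_conjugate_set:
  assumes "K \<subseteq> carrier G" "S \<subseteq> carrier G" "\<And>s. s \<in> S \<Longrightarrow> inv s \<in> S"
    and "x \<in> K <#> S <#> m_inv G ` K"
  shows "inv x \<in> K <#> S <#> m_inv G ` K"
proof -
  obtain a s b where x: "a \<in> K" "s \<in> S" "b \<in> K" "x = a \<otimes> s \<otimes> inv b"
    using assms(4) by (auto simp: set_mult_def)
  then have "inv x = b \<otimes> inv s \<otimes> inv a"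
    using assms(1,2) by (auto simp: inv_mult_group m_assoc subset_iff)
  then show ?thesis using x assms(3) by (auto simp: set_mult_def)
qed

end

section \<open>Cocompact subgroups\<close>

context topological_group
begin

context
  fixes H K f
  assumes Hausdorff: "Hausdorff_space T" and loc_compact: "locally_compact_space T"
    and H: "subgroup H G" and H_closed: "closedin T H"
    and K: "compactin T K" "\<one> \<in> K"
    and f: "\<And>g. g \<in> carrier G \<Longrightarrow> f g \<in> H" and f_H: "\<And>h. h \<in> H \<Longrightarrow> f h = h"
    and f_K: "\<And>g. g \<in> carrier G \<Longrightarrow> inv (f g) \<otimes> g \<in> K"
begin

interpretation H: subgroup H G by (rule H)

interpretation L: topological_group "G\<lparr>carrier := H\<rparr>" "subtopology T H"
  by (rule topological_group_subgroup[OF H])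

text \<open>A set containing all increments of \<open>f\<close> along edges labelled by
  \<open>S\<close>. As \<open>H\<close> is closed, it is compact whenever \<open>S\<close>
  is.\<close>

definition step_set :: "'a set \<Rightarrow> 'a set" where
  "step_set S = (K <#> S <#> m_inv G ` K) \<inter> H"

lemma K_carrier: "K \<subseteq> carrier G"
  by (rule compactin_subset_carrier[OF K(1)])

lemma f_closed: "g \<in> carrier G \<Longrightarrow> f g \<in> carrier G"
  using f H.mem_carrier by blast

lemma step_set_compact: "compactin T S \<Longrightarrow> compactin (subtopology T H) (step_set S)"
  unfolding step_set_def compactin_subtopology
  using K(1) H_closed
  by (auto intro!: compact_Int_closedin compactin_set_mult compactin_m_inv_image)

lemma step_set_increment:
  "g \<in> carrier G \<Longrightarrow> s \<in> S \<Longrightarrow> S \<subseteq> carrier G \<Longrightarrow> inv (f g) \<otimes> f (g \<otimes> s) \<in> step_set S"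
  unfolding step_set_def by (intro retraction_increment H f f_K)

lemma step_set_inv:
  assumes "S \<subseteq> carrier G" "\<And>s. s \<in> S \<Longrightarrow> inv s \<in> S" "x \<in> step_set S"
  shows "inv x \<in> step_set S"
  using inv_mem_conjugate_set[OF K_carrier assms(1,2)] assms(3) H.m_inv_closed
  by (simp add: step_set_def)

lemma transport_word_in_step_set:
  "S \<subseteq> carrier G \<Longrightarrow> set w \<subseteq> S \<Longrightarrow> set (transport_word G f \<one> w) \<subseteq> step_set S"
  using set_transport_word_subset[of S f "step_set S" \<one> w] step_set_increment by simp

lemma transport_word_in_H: "set w \<subseteq> H \<Longrightarrow> transport_word G f \<one> w = w"
  by (rule transport_word_fixed[OF H f_H H.one_closed])

lemma word_prod_transport_word_one:
  "set w \<subseteq> carrier G \<Longrightarrow> word_prod G (transport_word G f \<one> w) = f (word_prod G w)"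
  using word_prod_transport_word[OF f_closed one_closed] f_H[OF H.one_closed] f_closed by simp

text \<open>A closed subgroup is again locally compact Hausdorff, so the Baire argument applies
  inside \<open>H\<close>.\<close>

lemma compact_in_word_ball_H:
  assumes "compactin (subtopology T H) S" "\<And>h. h \<in> H \<Longrightarrow> \<exists>w. set w \<subseteq> S \<and> word_prod G w = h"
    and "compactin (subtopology T H) C"
  obtains n where "1 \<le> n" "C \<subseteq> word_ball G S n"
  using L.compactin_subset_word_ball[OF Hausdorff_space_subtopology[OF Hausdorff]
      locally_compact_space_closed_subset[OF loc_compact H_closed] assms(1) _ assms(3)] assms(2)
  by auto

text \<open>A loop in \<open>H\<close> is filled in \<open>G\<close> and the filling is pushed
  forward by \<open>f\<close>, which leaves the loop itself unchanged.\<close>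

lemma triangularly_presented_subgroup:
  assumes S0: "compactin T S0" "triangularly_presented_by G S0"
  shows "\<exists>S. compactin (subtopology T H) S \<and> triangularly_presented_by (G\<lparr>carrier := H\<rparr>) S"
proof -
  have S0G: "S0 \<subseteq> carrier G" and S0_inv: "\<And>s. s \<in> S0 \<Longrightarrow> inv s \<in> S0"
    and S0_gen: "\<And>g. g \<in> carrier G \<Longrightarrow> \<exists>w. set w \<subseteq> S0 \<and> word_prod G w = g"
    using S0(2) by (auto simp: triangularly_presented_by_def)
  define T0 where "T0 = step_set S0"
  have T0_compact: "compactin (subtopology T H) T0"
    unfolding T0_def by (rule step_set_compact[OF S0(1)])
  have T0H: "T0 \<subseteq> H" by (simp add: T0_def step_set_def)
  have T0_gen: "\<exists>w. set w \<subseteq> T0 \<and> word_prod G w = h" if "h \<in> H" for h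
  proof -
    obtain w where w: "set w \<subseteq> S0" "word_prod G w = h"
      using S0_gen[OF H.mem_carrier[OF \<open>h \<in> H\<close>]] by blast
    then show ?thesis
      using transport_word_in_step_set[OF S0G w(1)] word_prod_transport_word_one[of w] S0G f_H[OF that]
      by (intro exI[of _ "transport_word G f \<one> w"]) (auto simp: T0_def)
  qed
  \<comment> \<open>The steps of \<open>S0\<close> need not be letters of \<open>S0\<close>.
    Enlarging \<open>S0\<close> to a ball \<open>S\<close> that contains them makes every loop over
    \<open>T0\<close> a loop over \<open>S\<close>.\<close>
  obtain n where n: "1 \<le> n" "T0 \<subseteq> word_ball G S0 n"
    using compactin_subset_word_ball[OF Hausdorff loc_compact S0(1) S0_gen] T0_compact
    by (auto simp: compactin_subtopology)
  define S where "S = word_ball G S0 n"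
  have S: "triangularly_presented_by G S"
    unfolding S_def by (rule triangularly_presented_word_ball_self[OF S0(2) n(1)])
  have SG: "S \<subseteq> carrier G" using S by (simp add: triangularly_presented_by_def)
  have "compactin (subtopology T H) (step_set S)"
    unfolding S_def by (intro step_set_compact compactin_word_ball S0(1))
  \<comment> \<open>The pushed filling uses the larger set of steps of \<open>S\<close>; these are
    measured by the generators \<open>T0\<close> of \<open>H\<close>, so that a single ball contains
    all its letters.\<close>
  from compact_in_word_ball_H[OF T0_compact T0_gen this]
  obtain m where m: "1 \<le> m" "step_set S \<subseteq> word_ball G T0 m" by blast
  have "triangularly_presented_by (G\<lparr>carrier := H\<rparr>) (word_ball (G\<lparr>carrier := H\<rparr>) T0 m)"
  proof (rule L.triangularly_presented_word_ball)
    fix s assume "s \<in> T0"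
    then show "inv\<^bsub>G\<lparr>carrier := H\<rparr>\<^esub> s \<in> T0"
      using step_set_inv[OF S0G S0_inv] T0H m_inv_consistent[OF H] by (auto simp: T0_def)
  next
    fix w assume "set w \<subseteq> T0" "word_prod (G\<lparr>carrier := H\<rparr>) w = \<one>\<^bsub>G\<lparr>carrier := H\<rparr>\<^esub>"
    then have w: "set w \<subseteq> T0" "word_prod G w = \<one>" by simp_all
    then have "tri_equiv G S w []"
      using S n(2) by (auto simp: triangularly_presented_by_def S_def)
    then have "tri_equiv G (step_set S) (transport_word G f \<one> w) (transport_word G f \<one> [])"
      using SG f_closed step_set_increment by (intro tri_equiv_transport_word[where S = S]) auto
    then have "tri_equiv G (step_set S) w []"
      using transport_word_in_H[of w] w(1) T0H by simp
    then show "tri_equiv (G\<lparr>carrier := H\<rparr>) (word_ball (G\<lparr>carrier := H\<rparr>) T0 m) w []"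
      using m(2) by (simp add: tri_equiv_mono)
  qed (use T0H T0_gen m in auto)
  then show ?thesis using L.compactin_word_ball[OF T0_compact] by blast
qed

text \<open>Generators of \<open>H\<close> together with \<open>K\<close> generate \<open>G\<close>.
  A loop in \<open>G\<close> is moved across a strip to its image under \<open>f\<close>, rewritten
  over \<open>T0\<close>, and filled in \<open>H\<close>.\<close>

lemma triangularly_presented_overgroup:
  assumes T0: "compactin (subtopology T H) T0" "triangularly_presented_by (G\<lparr>carrier := H\<rparr>) T0"
  shows "\<exists>S. compactin T S \<and> triangularly_presented_by G S"
proof -
  have T0H: "T0 \<subseteq> H" and T0_inv: "\<And>s. s \<in> T0 \<Longrightarrow> inv s \<in> T0"
    and T0_gen: "\<And>h. h \<in> H \<Longrightarrow> \<exists>w. set w \<subseteq> T0 \<and> word_prod G w = h"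
    and T0_null: "\<And>w. set w \<subseteq> T0 \<Longrightarrow> word_prod G w = \<one> \<Longrightarrow> tri_equiv G T0 w []"
    using T0(2) m_inv_consistent[OF H] by (auto simp: triangularly_presented_by_def subset_iff)
  define S0 where "S0 = T0 \<union> (K \<union> m_inv G ` K)"
  have S0_compact: "compactin T S0"
    unfolding S0_def using T0(1) K(1)
    by (intro compactin_Un compactin_m_inv_image) (auto simp: compactin_subtopology)
  have S0G: "S0 \<subseteq> carrier G" by (rule compactin_subset_carrier[OF S0_compact])
  have T0G: "T0 \<subseteq> carrier G" using S0G by (simp add: S0_def)
  have S0_inv: "inv s \<in> S0" if "s \<in> S0" for s
    using that T0_inv K_carrier by (auto simp: S0_def)
  obtain m where m: "1 \<le> m" "step_set S0 \<subseteq> word_ball G T0 m"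
    using compact_in_word_ball_H[OF T0(1) T0_gen step_set_compact[OF S0_compact]] by blast
  \<comment> \<open>This radius is at least \<open>m\<close>, to contain the letters of image paths,
    and at least 2, to contain the diagonals of the strip.\<close>
  define n where "n = Suc m"
  define S where "S = word_ball G S0 n"
  have n: "1 \<le> n" "2 \<le> n" using m(1) by (auto simp: n_def)
  have ball_S: "word_ball G T0 m \<subseteq> S"
    unfolding S_def n_def by (rule word_ball_mono) (auto simp: S0_def)
  have S0S: "S0 \<subseteq> S" unfolding S_def by (rule subset_word_ball[OF S0G n(1)])
  have "triangularly_presented_by G (word_ball G S0 n)"
  proof (rule triangularly_presented_word_ball[OF S0G S0_inv n(1)])
    fix g assume g: "g \<in> carrier G"
    obtain w where w: "set w \<subseteq> T0" "word_prod G w = f g" using T0_gen[OF f[OF g]] by blast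
    have k: "inv (f g) \<otimes> g \<in> K" by (rule f_K[OF g])
    have "word_prod G (w @ [inv (f g) \<otimes> g]) = f g \<otimes> (inv (f g) \<otimes> g)"
      using w T0G g f_closed[OF g] by (simp add: word_prod_append subset_trans[OF w(1) T0G])
    also have "\<dots> = g" using g f_closed by (simp add: mult_inv_cancel_left)
    finally show "\<exists>w. set w \<subseteq> S0 \<and> word_prod G w = g"
      using w k by (intro exI[of _ "w @ [inv (f g) \<otimes> g]"]) (auto simp: S0_def)
  next
    fix w assume w: "set w \<subseteq> S0" "word_prod G w = \<one>"
    have K_S: "k \<in> S" if "k \<in> K" for k using that S0S by (auto simp: S0_def)
    have one: "\<one> \<in> S" using K_S K(2) .
    have diagonal: "inv (f g) \<otimes> (g \<otimes> s) \<in> S" if "g \<in> carrier G" "s \<in> S0" for g s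
    proof -
      have s: "s \<in> carrier G" using that S0G by blast
      have "inv (f g) \<otimes> g \<in> S0" using f_K[OF that(1)] by (simp add: S0_def)
      then have "word_prod G [inv (f g) \<otimes> g, s] \<in> S"
        unfolding S_def using that n by (intro word_ballI) auto
      then show ?thesis using that s f_closed by (simp add: m_assoc)
    qed
    \<comment> \<open>Since \<open>f\<close> fixes the identity and \<open>w\<close> is a loop, both
      ends of the strip turn into the letter \<open>\<one>\<close>.\<close>
    have "tri_equiv G S ((inv (f \<one>) \<otimes> \<one>) # w)
        (transport_word G f \<one> w @ [inv (f (\<one> \<otimes> word_prod G w)) \<otimes> (\<one> \<otimes> word_prod G w)])"
      using step_set_increment[OF _ _ S0G] m(2) ball_S f_K K_S w(1)
      by (intro tri_equiv_transport_word_conjugate[OF S0G S0S f_closed _ diagonal]) blast+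
    then have strip: "tri_equiv G S (\<one> # w) (transport_word G f \<one> w @ [\<one>])"
      using w(2) f_H[OF H.one_closed] by simp
    have t: "set (transport_word G f \<one> w) \<subseteq> word_ball G T0 m"
      using transport_word_in_step_set[OF S0G w(1)] m(2) by blast
    obtain v where v: "set v \<subseteq> T0" "tri_equiv G (word_ball G T0 m) (transport_word G f \<one> w) v"
      using word_ball_word_refine[OF T0G m(1) t] by blast
    have "word_prod G v = word_prod G (transport_word G f \<one> w)"
      using tri_equiv_word_prod[OF v(2) word_ball_subset_carrier[OF T0G]] by simp
    also have "\<dots> = \<one>"
      using w S0G f_H[OF H.one_closed] by (simp add: word_prod_transport_word_one)
    finally have "tri_equiv G T0 v []" by (rule T0_null[OF v(1)])
    then have "tri_equiv G S v []"
      by (rule tri_equiv_mono) (use S0S in \<open>simp add: S0_def\<close>)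
    then have null: "tri_equiv G S (transport_word G f \<one> w) []"
      using tri_equiv_mono[OF v(2) ball_S] tri_equiv.trans by metis
    have "tri_equiv G S ([] @ w) ([\<one>] @ w)"
      using w(1) S0S by (intro tri_equiv.append tri_equiv.sym[OF tri_equiv.one[OF one]] tri_equiv.refl) auto
    also have "tri_equiv G S ([\<one>] @ w) (transport_word G f \<one> w @ [\<one>])" using strip by simp
    also have "tri_equiv G S (transport_word G f \<one> w @ [\<one>]) ([] @ [])"
      by (rule tri_equiv.append[OF null tri_equiv.one[OF one]])
    finally show "tri_equiv G (word_ball G S0 n) w []" by (simp add: S_def)
  qed
  then show ?thesis using compactin_word_ball[OF S0_compact] by blast
qed

end

end

theorem proposition3p11:
  fixes G :: "('a, 'b) monoid_scheme" and T :: "'a topology" and H :: "'a set"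
  assumes "topological_group G T"
    and "Hausdorff_space T"
    and "locally_compact_space T"
    and "subgroup H G"
    and "closedin T H"
    and "\<exists>K. compactin T K \<and> carrier G = H <#>\<^bsub>G\<^esub> K"
  shows "compactly_presented G T
    \<longleftrightarrow> compactly_presented (G\<lparr>carrier := H\<rparr>) (subtopology T H)"
proof -
  interpret topological_group G T by fact
  interpret L: topological_group "G\<lparr>carrier := H\<rparr>" "subtopology T H"
    by (rule topological_group_subgroup[OF assms(4)])
  obtain K where K: "compactin T K" "carrier G = H <#>\<^bsub>G\<^esub> K" using assms(6) by blast
  obtain f where f: "\<And>g. g \<in> carrier G \<Longrightarrow> f g \<in> H" "\<And>h. h \<in> H \<Longrightarrow> f h = h"
      "\<And>g. g \<in> carrier G \<Longrightarrow> inv\<^bsub>G\<^esub> (f g) \<otimes>\<^bsub>G\<^esub> g \<in> insert \<one>\<^bsub>G\<^esub> K"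
    using subgroup_retraction[OF assms(4) compactin_subset_carrier[OF K(1)] K(2)] by blast
  \<comment> \<open>The compact set in force from here on is \<open>insert \<one> K\<close>, which
    contains the identity as the retraction requires.\<close>
  note retraction = assms(2-5) compactin_insert_one[OF K(1)] insertI1 f
  show ?thesis
    unfolding compactly_presented_iff L.compactly_presented_iff
    using triangularly_presented_subgroup[OF retraction] triangularly_presented_overgroup[OF retraction]
      assms(2) Hausdorff_space_subtopology[OF assms(2)]
    by blast
qed

end
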